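(* Let $(X,f)$ be a topologically transitive dynamical system with $X$ a Hausdorff space that contains isolated points, and let $\mathrm{Iso}_X$ be the set of isolated points of $X$. Then the system has a dense orbit, and exactly one of the following Cases 1, 2, 3 occurs: Case 1. There exists a unique $x\in \mathrm{Iso}_X$ such that $f^{-1}(x)=\varnothing$. Then $\mathrm{Trans}_f=\{x\}$ and $f(X)$ is not dense in $X$. In this case $\mathrm{DO}_+$ holds, but $\mathrm{TT}_+$ (and hence $\mathrm{TT}_{++}$ and $\mathrm{DO}_{++}$) does not. Exactly one of the following occurs: (1a) $\mathrm{Iso}_X=O_\pm(x)=O(x)$ consists of infinitely many distinct points in a single forward orbit, and $\mathrm{Iso}_X$ is dense in $X$. (1b) $\mathrm{Iso}_X=O_\pm(x)=O(x)=X$ is a finite, pre-periodic forward orbit of period $\ell$: $y=f^k(x)$ is periodic for some minimum $k>0$, and $f^{-1}(y)=\{f^{k-1}(x),f^{\ell-1}(y)\}$. (1c) $\mathrm{Iso}_X=\{f^k(x):0\le k\le n-1\}$ is a finite sequence of distinct points, for some $n\ge 0$. For $k\ge n$, $f^k(x)$ is not isolated, and $X$ is infinite. The finite set $\mathrm{Iso}_X$ is not dense in $X$. $O(x)=O_\pm(x)$ is dense in $X$. Case 2. For every point $z\in\mathrm{Iso}_X$ the set $f^{-1}(z)$ is nonempty, and there exists $x\in \mathrm{Iso}_X$ such that $f^{-1}(x)$ contains two points. In that case the point $x$ is unique; $\mathrm{Iso}_X=O_\pm(x)$ is an infinite, pre-periodic orbit of period $\ell$, and $f^{-1}(x)=\{y,f^{\ell-1}(x)\}$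 for some $y$. For all $k\in\mathbb N$, $f^{-k}(y)$ is a single isolated point. $\mathrm{Trans}_f=\varnothing$, and $\mathrm{Iso}_X$ and $f(X)$ are dense in $X$. Case 3. For every $x\in\mathrm{Iso}_X$ the preimage $f^{-1}(x)$ is a singleton, and exactly one of the following occurs: (3a) $X=f(X)=\mathrm{Trans}_f=\mathrm{Iso}_X$ is a single periodic orbit. This is the only one of all the listed cases satisfying $\mathrm{TT}_{++}$, $\mathrm{TT}_+$, or $\mathrm{DO}_{++}$. (3b) For each $x\in \mathrm{Iso}_X$, the bi-infinite orbit $O_\pm(x)$ equals $\mathrm{Iso}_X$. $\mathrm{Trans}_f=\varnothing$, $\mathrm{Iso}_X$ is dense in $X$, and $f(X)$ is dense in $X$. (3c) There is a unique $y\in\mathrm{Iso}_X$ such that $f(y)\notin\mathrm{Iso}_X$. $\mathrm{Iso}_X=\{f^{-k}(y):k\in\mathbb N\}$ forms an infinite sequence ending in $y$, and for $k>0$, $f^k(y)$ is not isolated. $\mathrm{Trans}_f=\varnothing$ and $f(X)$ is dense in $X$. ($\mathrm{Iso}_X$ may or may not be dense in $X$.)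
   Context: A dynamical system $(X,f)$ is a continuous map $f\colon X\to X$ on a nonempty topological space $X$. $\mathbb N$ is the set of nonnegative integers. For $A\subset X$, $k\in\mathbb Z$, $f^k(A)$ is the image of $A$ under $f^k$ if $k\ge 0$ and the preimage of $A$ under $f^{|k|}$ if $k<0$; $f^{-k}(x)$ means $f^{-k}(\{x\})$, and a singleton is identified with the point in it when convenient. A set is opene if it is open and nonempty. A point $x$ is isolated if $\{x\}$ is open. $O(x)=\{f^k(x):k\in\mathbb N\}$ is the forward orbit, $O_\pm(x)=\bigcup_{k\in\mathbb Z}f^k(\{x\})$, and $\omega f(x)=\bigcap_{n\ge0}\overline{\{f^k(x):k\ge n\}}$. For $A,B\subset X$: $N(A,B)=\{k\in\mathbb Z: A\cap f^{-k}(B)\ne\varnothing\}$ and $N_+(A,B)=N(A,B)\cap\mathbb N$. $\mathrm{Trans}_f=\{x\in X: O(x)\text{ is dense in }X\}$ is the set of transitive points. An orbit sequence is either a bi-infinite sequence $\langle x_k:k\in\mathbb Z\rangle$ with $f(x_k)=x_{k+1}$ for all $k$, or a sequence $\langle x_k:k\ge n\rangle$ with $f(x_k)=x_{k+1}$ for $k\ge n$ and $f^{-1}(\{x_n\})=\varnothing$; its set of elements is called an orbit. An orbit is pre-periodic of period $\ell$ when it eventually enters a periodic cycle of (minimal) period $\ell$ without being equal to that cycle (in (1b) the cycle is that of $y$; in Case 2 the cycle is that of $x$, so $x$ is periodic of period $\ell$). $(X,f)$ is topologically transitive if $N(U,V)\ne\varnothing$ for all opene $U,V\subset X$. $\mathrm{TT}_+$: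 $N_+(U,V)\ne\varnothing$ for all opene $U,V$. $\mathrm{TT}_{++}$: $N_+(U,V)$ is infinite for all opene $U,V$. $\mathrm{DO}_+$: $\mathrm{Trans}_f\neq\varnothing$. $\mathrm{DO}_{++}$: there is $x\in X$ with $\omega f(x)=X$. *)

theory Defs
  imports "HOL-Analysis.Analysis"
begin

text \<open>
  A dynamical system on a topological space is a continuous self-map \<open>f :: 'a \<Rightarrow> 'a\<close>, where the
  space \<open>X\<close> is the whole type \<open>'a\<close> (types are nonempty).  A set \<open>S\<close> is dense iff
  \<open>closure S = UNIV\<close>.
\<close>

definition isolated_points :: "'a::topological_space set" where
  "isolated_points = {x. open {x}}"

definition iter_image :: "('a \<Rightarrow> 'a) \<Rightarrow> int \<Rightarrow> 'a set \<Rightarrow> 'a set" where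
  "iter_image f k A = (if k \<ge> 0 then (f ^^ nat k) ` A else (f ^^ nat (- k)) -` A)"

definition forward_orbit :: "('a \<Rightarrow> 'a) \<Rightarrow> 'a \<Rightarrow> 'a set" where
  "forward_orbit f x = range (\<lambda>k::nat. (f ^^ k) x)"

definition full_orbit :: "('a \<Rightarrow> 'a) \<Rightarrow> 'a \<Rightarrow> 'a set" where
  "full_orbit f x = (\<Union>k::int. iter_image f k {x})"

definition omega_limit :: "('a::topological_space \<Rightarrow> 'a) \<Rightarrow> 'a \<Rightarrow> 'a set" where
  "omega_limit f x = (\<Inter>n::nat. closure {(f ^^ k) x | k. k \<ge> n})"

definition hitting_times :: "('a \<Rightarrow> 'a) \<Rightarrow> 'a set \<Rightarrow> 'a set \<Rightarrow> int set" where
  "hitting_times f A B = {k. A \<inter> iter_image f (- k) B \<noteq> {}}"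

definition hitting_times_plus :: "('a \<Rightarrow> 'a) \<Rightarrow> 'a set \<Rightarrow> 'a set \<Rightarrow> int set" where
  "hitting_times_plus f A B = hitting_times f A B \<inter> {k. k \<ge> 0}"

definition transitive_points :: "('a::topological_space \<Rightarrow> 'a) \<Rightarrow> 'a set" where
  "transitive_points f = {x. closure (forward_orbit f x) = UNIV}"

definition opene :: "'a::topological_space set \<Rightarrow> bool" where
  "opene U \<longleftrightarrow> open U \<and> U \<noteq> {}"

definition topologically_transitive :: "('a::topological_space \<Rightarrow> 'a) \<Rightarrow> bool" where
  "topologically_transitive f \<longleftrightarrow>
     (\<forall>U V. opene U \<and> opene V \<longrightarrow> hitting_times f U V \<noteq> {})"

definition TT_plus :: "('a::topological_space \<Rightarrow> 'a) \<Rightarrow> bool" where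
  "TT_plus f \<longleftrightarrow> (\<forall>U V. opene U \<and> opene V \<longrightarrow> hitting_times_plus f U V \<noteq> {})"

definition TT_plusplus :: "('a::topological_space \<Rightarrow> 'a) \<Rightarrow> bool" where
  "TT_plusplus f \<longleftrightarrow> (\<forall>U V. opene U \<and> opene V \<longrightarrow> infinite (hitting_times_plus f U V))"

definition DO_plus :: "('a::topological_space \<Rightarrow> 'a) \<Rightarrow> bool" where
  "DO_plus f \<longleftrightarrow> transitive_points f \<noteq> {}"

definition DO_plusplus :: "('a::topological_space \<Rightarrow> 'a) \<Rightarrow> bool" where
  "DO_plusplus f \<longleftrightarrow> (\<exists>x. omega_limit f x = UNIV)"

text \<open>
  An orbit sequence is indexed by an index set \<open>I\<close> of integers, which is either all of \<open>UNIV\<close>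
  or a half-line \<open>{n..}\<close> starting at a point without preimages; values of \<open>s\<close> outside \<open>I\<close>
  are irrelevant.
\<close>

definition orbit_sequence :: "('a \<Rightarrow> 'a) \<Rightarrow> int set \<Rightarrow> (int \<Rightarrow> 'a) \<Rightarrow> bool" where
  "orbit_sequence f I s \<longleftrightarrow>
     (\<forall>k\<in>I. f (s k) = s (k + 1)) \<and>
     (I = UNIV \<or> (\<exists>n. I = {n..} \<and> f -` {s n} = {}))"

definition is_orbit :: "('a \<Rightarrow> 'a) \<Rightarrow> 'a set \<Rightarrow> bool" where
  "is_orbit f S \<longleftrightarrow> (\<exists>I s. orbit_sequence f I s \<and> S = s ` I)"

definition has_dense_orbit :: "('a::topological_space \<Rightarrow> 'a) \<Rightarrow> bool" where
  "has_dense_orbit f \<longleftrightarrow> (\<exists>S. is_orbit f S \<and> closure S = UNIV)"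

definition periodic_point :: "('a \<Rightarrow> 'a) \<Rightarrow> 'a \<Rightarrow> bool" where
  "periodic_point f x \<longleftrightarrow> (\<exists>l>0. (f ^^ l) x = x)"

definition minimal_period :: "('a \<Rightarrow> 'a) \<Rightarrow> 'a \<Rightarrow> nat \<Rightarrow> bool" where
  "minimal_period f x l \<longleftrightarrow> l > 0 \<and> (f ^^ l) x = x \<and> (\<forall>j. 0 < j \<and> j < l \<longrightarrow> (f ^^ j) x \<noteq> x)"

text \<open>The orbit \<open>S\<close> is pre-periodic of period \<open>l\<close>, the cycle it enters being that of \<open>z\<close>.\<close>

definition preperiodic_orbit :: "('a \<Rightarrow> 'a) \<Rightarrow> 'a set \<Rightarrow> 'a \<Rightarrow> nat \<Rightarrow> bool" where
  "preperiodic_orbit f S z l \<longleftrightarrow>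
     minimal_period f z l \<and> S \<noteq> forward_orbit f z \<and>
     (\<exists>I s. orbit_sequence f I s \<and> S = s ` I \<and> (\<exists>m\<in>I. \<forall>k\<ge>m. s k \<in> forward_orbit f z))"

definition is_single_periodic_orbit_system :: "('a::topological_space \<Rightarrow> 'a) \<Rightarrow> bool" where
  "is_single_periodic_orbit_system f \<longleftrightarrow>
     range f = UNIV \<and> transitive_points f = UNIV \<and> (isolated_points :: 'a set) = UNIV \<and>
     (\<exists>x. periodic_point f x \<and> forward_orbit f x = UNIV)"

definition exactly_one_of :: "bool \<Rightarrow> bool \<Rightarrow> bool \<Rightarrow> bool" where
  "exactly_one_of P Q R \<longleftrightarrow>
     (P \<and> \<not> Q \<and> \<not> R) \<or> (\<not> P \<and> Q \<and> \<not> R) \<or> (\<not> P \<and> \<not> Q \<and> R)"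

definition unique_isolated_without_preimage :: "('a::topological_space \<Rightarrow> 'a) \<Rightarrow> bool" where
  "unique_isolated_without_preimage f \<longleftrightarrow> (\<exists>!x. x \<in> isolated_points \<and> f -` {x} = {})"

text \<open>At least two distinct preimages.\<close>

definition has_two_preimages :: "('a \<Rightarrow> 'a) \<Rightarrow> 'a \<Rightarrow> bool" where
  "has_two_preimages f x \<longleftrightarrow> (\<exists>a b. a \<noteq> b \<and> {a, b} \<subseteq> f -` {x})"

definition isolated_preimages_nonempty_some_two :: "('a::topological_space \<Rightarrow> 'a) \<Rightarrow> bool" where
  "isolated_preimages_nonempty_some_two f \<longleftrightarrow>
     (\<forall>z\<in>isolated_points. f -` {z} \<noteq> {}) \<and> (\<exists>x\<in>isolated_points. has_two_preimages f x)"

definition isolated_preimages_singletons :: "('a::topological_space \<Rightarrow> 'a) \<Rightarrow> bool" where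
  "isolated_preimages_singletons f \<longleftrightarrow> (\<forall>x\<in>isolated_points. is_singleton (f -` {x}))"

end

theory Submission
  imports Defs
begin

text \<open>
  Everything rests on two consequences of transitivity. Of two isolated points, one lies on the
  forward orbit of the other, so the isolated points form a chain; and the full orbit of an
  isolated point is dense. If the preimage of an isolated point \<open>x\<close> contains two disjoint opene
  sets, an orbit passing from one of them to the other returns to \<open>x\<close>, so \<open>x\<close> is periodic and one
  of the two sets contains its cyclic predecessor. Hence \<open>x\<close> has at most two preimages, all of them
  isolated. The cases then correspond to the possible shapes of a chain: it has a first point
  (Case 1), it branches where it enters a cycle (Case 2), or it can be traced back uniquely forever
  (Case 3).
\<close>

section \<open>Orbits and hitting times in terms of natural-number iterates\<close>

lemma mem_forward_orbit_iff: "v \<in> forward_orbit f x \<longleftrightarrow> (\<exists>n. v = (f ^^ n) x)"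
  by (auto simp: forward_orbit_def)

lemma iter_image_minus_int_singleton: "iter_image f (- int k) {x} = {v. (f ^^ k) v = x}"
  \<comment> \<open>At \<open>k = 0\<close> the definition of \<open>iter_image\<close> takes its
    image branch; both branches agree there since \<open>f ^^ 0\<close> is the identity.\<close>
  by (cases "k = 0") (auto simp: iter_image_def)

lemma mem_full_orbit_iff:
  "v \<in> full_orbit f x \<longleftrightarrow> v \<in> forward_orbit f x \<or> (\<exists>n. (f ^^ n) v = x)"
proof
  assume "v \<in> full_orbit f x"
  then show "v \<in> forward_orbit f x \<or> (\<exists>n. (f ^^ n) v = x)"
    by (auto simp: full_orbit_def iter_image_def forward_orbit_def split: if_splits)
next
  assume "v \<in> forward_orbit f x \<or> (\<exists>n. (f ^^ n) v = x)"
  then consider n where "v = (f ^^ n) x" | n where "(f ^^ n) v = x"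
    by (auto simp: mem_forward_orbit_iff)
  then show "v \<in> full_orbit f x"
  proof cases
    case 1
    then have "v \<in> iter_image f (int n) {x}" by (simp add: iter_image_def)
    then show ?thesis unfolding full_orbit_def by blast
  next
    case 2
    then have "v \<in> iter_image f (- int n) {x}" by (simp add: iter_image_minus_int_singleton)
    then show ?thesis unfolding full_orbit_def by blast
  qed
qed

lemma hitting_times_plus_int_iff:
  "k \<in> hitting_times_plus f U V \<longleftrightarrow> k \<ge> 0 \<and> (\<exists>u\<in>U. (f ^^ nat k) u \<in> V)"
  by (cases "k = 0") (auto simp: hitting_times_plus_def hitting_times_def iter_image_def)

text \<open>A negative hitting time from \<open>U\<close> to \<open>V\<close> is a forward passage
  from \<open>V\<close> to \<open>U\<close>; this symmetry is what later makes isolated points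
  comparable.\<close>

lemma hitting_times_nonempty_iff:
  "hitting_times f U V \<noteq> {} \<longleftrightarrow>
     (\<exists>n. (\<exists>u\<in>U. (f ^^ n) u \<in> V) \<or> (\<exists>v\<in>V. (f ^^ n) v \<in> U))"
proof
  assume "hitting_times f U V \<noteq> {}"
  then obtain k where "U \<inter> iter_image f (- k) V \<noteq> {}" by (auto simp: hitting_times_def)
  then show "\<exists>n. (\<exists>u\<in>U. (f ^^ n) u \<in> V) \<or> (\<exists>v\<in>V. (f ^^ n) v \<in> U)"
    by (auto simp: iter_image_def split: if_splits)
next
  assume "\<exists>n. (\<exists>u\<in>U. (f ^^ n) u \<in> V) \<or> (\<exists>v\<in>V. (f ^^ n) v \<in> U)"
  then consider n where "\<exists>u\<in>U. (f ^^ n) u \<in> V" | n where "\<exists>v\<in>V. (f ^^ n) v \<in> U" by blast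
  then show "hitting_times f U V \<noteq> {}"
  proof cases
    case 1
    then have "int n \<in> hitting_times_plus f U V" by (simp add: hitting_times_plus_int_iff)
    then show ?thesis by (auto simp: hitting_times_plus_def)
  next
    case 2
    then have "- int n \<in> hitting_times f U V" by (auto simp: hitting_times_def iter_image_def)
    then show ?thesis by blast
  qed
qed

section \<open>Periodic points and minimal periods\<close>

lemma funpow_funpow: "(f ^^ m) ((f ^^ n) x) = (f ^^ (m + n)) x"
  by (simp add: funpow_add)

lemma funpow_multiple_period: "(f ^^ l) x = x \<Longrightarrow> (f ^^ (l * m)) x = x"
  by (induction m) (simp_all add: funpow_add)

lemma periodic_point_funpow:
  assumes "periodic_point f x"
  shows "periodic_point f ((f ^^ n) x)"
proof -
  obtain l where l: "l > 0" "(f ^^ l) x = x" using assms by (auto simp: periodic_point_def)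
  have "(f ^^ l) ((f ^^ n) x) = (f ^^ n) ((f ^^ l) x)"
    by (simp add: funpow_funpow add.commute)
  then show ?thesis using l by (auto simp: periodic_point_def)
qed

lemma periodic_point_reaches_back:
  assumes "periodic_point f x"
  shows "\<exists>m. (f ^^ m) ((f ^^ n) x) = x"
proof -
  obtain l where l: "l > 0" "(f ^^ l) x = x" using assms by (auto simp: periodic_point_def)
  \<comment> \<open>\<open>l * n\<close> is a multiple of the period not smaller than
    \<open>n\<close>, so \<open>l * n - n\<close> further steps return to \<open>x\<close>.\<close>
  have "n \<le> l * n" using l by simp
  then have "(f ^^ (l * n - n)) ((f ^^ n) x) = (f ^^ (l * n)) x"
    by (simp add: funpow_funpow)
  then show ?thesis using funpow_multiple_period[OF l(2)] by metis
qed

lemma minimal_period_exists: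
  assumes "periodic_point f x"
  shows "\<exists>l. minimal_period f x l"
proof -
  let ?P = "\<lambda>l. l > 0 \<and> (f ^^ l) x = x"
  have "?P (LEAST l. ?P l)"
    using assms by (intro LeastI_ex[of ?P]) (auto simp: periodic_point_def)
  moreover have "\<forall>j. 0 < j \<and> j < (LEAST l. ?P l) \<longrightarrow> (f ^^ j) x \<noteq> x"
    using not_less_Least[of _ ?P] by blast
  ultimately show ?thesis unfolding minimal_period_def by blast
qed

lemma funpow_eq_imp_periodic:
  assumes "(f ^^ i) x = (f ^^ j) x" "i < j"
  shows "periodic_point f ((f ^^ i) x)"
proof -
  have "(f ^^ (j - i)) ((f ^^ i) x) = (f ^^ j) x"
    using assms(2) by (simp add: funpow_funpow)
  then show ?thesis using assms by (auto simp: periodic_point_def intro!: exI[of _ "j - i"])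
qed

lemma finite_forward_orbit_periodic:
  assumes "periodic_point f x"
  shows "finite (forward_orbit f x)"
proof -
  obtain l where l: "l > 0" "(f ^^ l) x = x" using assms by (auto simp: periodic_point_def)
  have "(f ^^ n) x = (f ^^ (n mod l)) x" for n
    using funpow_mod_eq[OF l(2)] by simp
  then have "forward_orbit f x \<subseteq> (\<lambda>k. (f ^^ k) x) ` {..<l}"
    using l(1) by (fastforce simp: mem_forward_orbit_iff)
  then show ?thesis using finite_surj by blast
qed

text \<open>The point \<open>w\<close> lies on the cycle of \<open>f w = x\<close>, hence is fixed
  by \<open>f ^^ l\<close>; but \<open>f ^^ l\<close> applied to \<open>w\<close> is
  \<open>f ^^ (l - 1)\<close> applied to \<open>x\<close>. This makes \<open>f\<close> injective on
  periodic points.\<close>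

lemma periodic_predecessor:
  assumes "minimal_period f x l" "periodic_point f w" "f w = x"
  shows "w = (f ^^ (l - 1)) x"
proof -
  have l: "l > 0" "(f ^^ l) x = x" using assms(1) by (auto simp: minimal_period_def)
  obtain m where m: "(f ^^ m) x = w"
    using periodic_point_reaches_back[OF assms(2), of 1] assms(3) by auto
  have "f ((f ^^ (l - 1)) x) = x" using l by (metis Suc_diff_1 comp_apply funpow.simps(2))
  then have "(f ^^ l) w = (f ^^ (l - 1)) x"
    using l assms(3) by (metis Suc_diff_1 comp_apply funpow_Suc_right)
  moreover have "(f ^^ l) w = (f ^^ m) ((f ^^ l) x)"
    by (simp add: funpow_funpow add.commute flip: m)
  ultimately show ?thesis using l m by simp
qed

lemma minimal_period_predecessor:
  assumes "minimal_period f x l"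
  shows "f ((f ^^ (l - 1)) x) = x"
  using assms unfolding minimal_period_def by (metis Suc_diff_1 comp_apply funpow.simps(2))

section \<open>Backward orbits, orbit sequences and small topological facts\<close>

text \<open>The fibre of order \<open>k + 1\<close> over \<open>p\<close> is the preimage of the
  single point in the fibre of order \<open>k\<close>, so all fibres stay singletons; their points
  form a backward trajectory \<open>z\<close> ending in \<open>p\<close>.\<close>

lemma iterated_preimages_singleton:
  assumes "\<forall>v n. (f ^^ n) v = p \<longrightarrow> is_singleton (f -` {v})"
  shows "\<exists>z. z 0 = p \<and> (\<forall>k. {v. (f ^^ k) v = p} = {z k}) \<and> (\<forall>k. f (z (Suc k)) = z k)"
proof -
  have ex: "\<exists>w. {v. (f ^^ k) v = p} = {w}" for k
  proof (induction k)
    case (Suc k)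
    then obtain w where w: "{v. (f ^^ k) v = p} = {w}" by blast
    then have "is_singleton (f -` {w})" using assms by blast
    moreover have "{v. (f ^^ Suc k) v = p} = f -` {w}"
      using w by (auto simp: funpow_Suc_right simp del: funpow.simps)
    ultimately show ?case by (metis is_singletonE)
  qed auto
  then obtain z where z: "\<And>k. {v. (f ^^ k) v = p} = {z k}" by metis
  have "f (z (Suc k)) = z k" for k
  proof -
    have "(f ^^ Suc k) (z (Suc k)) = p" using z[of "Suc k"] by blast
    then have "f (z (Suc k)) \<in> {v. (f ^^ k) v = p}"
      by (simp add: funpow_Suc_right del: funpow.simps)
    then show ?thesis using z by simp
  qed
  moreover have "z 0 = p" using z[of 0] by auto
  ultimately show ?thesis using z by blast
qed

text \<open>The unique backward trajectory of \<open>p\<close> is glued to its forward orbit.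
  Injectivity of \<open>s\<close> is not claimed, so orbits that later enter a cycle are covered as
  well; the values at nonnegative indices are recorded to locate that cycle.\<close>

lemma full_orbit_bi_infinite:
  assumes "\<forall>v n. (f ^^ n) v = p \<longrightarrow> is_singleton (f -` {v})"
  shows "\<exists>s. orbit_sequence f UNIV s \<and> range s = full_orbit f p \<and> (\<forall>k\<ge>0. s k = (f ^^ nat k) p)"
proof -
  obtain z where z: "z 0 = p" "\<And>k. {v. (f ^^ k) v = p} = {z k}" "\<And>k. f (z (Suc k)) = z k"
    using iterated_preimages_singleton[of f p, OF assms] by blast
  define s where "s k = (if k \<ge> 0 then (f ^^ nat k) p else z (nat (- k)))" for k :: int
  have "f (s k) = s (k + 1)" for k
  proof (cases "k \<ge> 0")
    case True
    then show ?thesis by (simp add: s_def nat_add_distrib)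
  next
    case False
    then have "nat (- k) = Suc (nat (- (k + 1)))" by simp
    then have "f (s k) = z (nat (- (k + 1)))" using False z(3) by (simp add: s_def)
    \<comment> \<open>At \<open>k = -1\<close> the successor falls into the forward branch of
      \<open>s\<close>, which meets the backward one because \<open>z 0 = p\<close>.\<close>
    also have "\<dots> = s (k + 1)" using False z(1) by (cases "k = -1") (auto simp: s_def)
    finally show ?thesis .
  qed
  then have "orbit_sequence f UNIV s" by (simp add: orbit_sequence_def)
  moreover have "range s = full_orbit f p"
  proof (intro set_eqI iffI)
    fix v assume "v \<in> range s"
    then show "v \<in> full_orbit f p"
      using z(2) by (auto simp: mem_full_orbit_iff mem_forward_orbit_iff s_def split: if_splits)
  next
    fix v assume "v \<in> full_orbit f p"
    then consider n where "v = (f ^^ n) p" | n where "(f ^^ n) v = p"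
      by (auto simp: mem_full_orbit_iff mem_forward_orbit_iff)
    then show "v \<in> range s"
    proof cases
      case 1
      then have "v = s (int n)" by (simp add: s_def)
      then show ?thesis by blast
    next
      case 2
      then have "v = z n" using z(2) by blast
      then have "v = s (- int n)" using z(1) by (cases "n = 0") (auto simp: s_def)
      then show ?thesis by blast
    qed
  qed
  moreover have "\<forall>k\<ge>0. s k = (f ^^ nat k) p" by (simp add: s_def)
  ultimately show ?thesis by blast
qed

lemma periodic_point_preimage: "periodic_point f x \<Longrightarrow> f -` {x} \<noteq> {}"
  by (metis empty_iff minimal_period_exists minimal_period_predecessor vimage_singleton_eq)

lemma TT_plusplus_imp_TT_plus: "TT_plusplus f \<Longrightarrow> TT_plus f"
  unfolding TT_plusplus_def TT_plus_def by fastforce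

lemma no_preimage_funpow: "f -` {x} = {} \<Longrightarrow> (f ^^ n) v = x \<Longrightarrow> n = 0 \<and> v = x"
  by (cases n) auto

lemma forward_orbit_sequence:
  assumes "f -` {x} = {}"
  shows "orbit_sequence f {0..} (\<lambda>i. (f ^^ nat i) x)"
    and "forward_orbit f x = (\<lambda>i. (f ^^ nat i) x) ` {0..}"
proof -
  show "orbit_sequence f {0..} (\<lambda>i. (f ^^ nat i) x)"
    using assms by (auto simp: orbit_sequence_def nat_add_distrib)
  show "forward_orbit f x = (\<lambda>i. (f ^^ nat i) x) ` {0..}"
    by (force simp: mem_forward_orbit_iff image_iff intro: bexI[of _ "int _"])
qed

text \<open>Meant for the periodic and for the nonperiodic preimages of an isolated point, of which
  there is at most one each.\<close>

lemma finite_if_all_equal: "(\<And>a b. a \<in> A \<Longrightarrow> b \<in> A \<Longrightarrow> a = b) \<Longrightarrow> finite A"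
  by (metis finite.emptyI is_singletonE is_singletonI' finite.insertI)

lemma open_singleton_mem_dense:
  assumes "open {x}" "closure S = UNIV"
  shows "x \<in> S"
proof -
  have "x \<in> closure S" using assms(2) by simp
  then have "{x} \<inter> S \<noteq> {}" using open_Int_closure_eq_empty[OF assms(1), of S] by blast
  then show ?thesis by blast
qed

section \<open>First consequences of transitivity for isolated points\<close>

locale transitive_system_with_isolated_points =
  fixes f :: "'a::t2_space \<Rightarrow> 'a"
  assumes continuous: "continuous_on UNIV f"
    and transitive: "topologically_transitive f"
    and isolated_nonempty: "(isolated_points :: 'a set) \<noteq> {}"
begin

abbreviation Iso :: "'a set" where "Iso \<equiv> isolated_points"

lemma transitiveE:
  assumes "open U" "U \<noteq> {}" "open V" "V \<noteq> {}"
  obtains n u where "u \<in> U" "(f ^^ n) u \<in> V" | n v where "v \<in> V" "(f ^^ n) v \<in> U"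
  using transitive assms
  unfolding topologically_transitive_def hitting_times_nonempty_iff opene_def by metis

lemma open_preimage:
  assumes "x \<in> Iso"
  shows "open (f -` {x})"
  using continuous assms continuous_on_open_vimage[of UNIV f] by (auto simp: isolated_points_def)

lemma isolated_comparable:
  assumes "x \<in> Iso" "z \<in> Iso"
  obtains n where "(f ^^ n) x = z" | n where "(f ^^ n) z = x"
  using transitiveE[of "{x}" "{z}"] assms by (auto simp: isolated_points_def)

lemma isolated_subset_full_orbit:
  assumes "x \<in> Iso"
  shows "Iso \<subseteq> full_orbit f x"
proof
  fix z assume "z \<in> Iso"
  with assms show "z \<in> full_orbit f x"
    by (rule isolated_comparable) (auto simp: mem_full_orbit_iff mem_forward_orbit_iff)
qed

lemma full_orbit_dense:
  assumes "x \<in> Iso"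
  shows "closure (full_orbit f x) = UNIV"
proof -
  have "V \<inter> full_orbit f x \<noteq> {}" if V: "open V" "V \<noteq> {}" for V
    by (rule transitiveE[of "{x}" V])
      (use assms V in \<open>fastforce simp: isolated_points_def mem_full_orbit_iff mem_forward_orbit_iff\<close>)+
  \<comment> \<open>The complement of the closure is an open set missing the full orbit, hence
    empty.\<close>
  from this[of "- closure (full_orbit f x)"] show ?thesis
    using closure_subset[of "full_orbit f x"] by blast
qed

section \<open>Preimages of isolated points\<close>

text \<open>Key to bounding the fibre over \<open>x\<close>: its parts free of periodic points
  cannot be separated by open sets. Transitivity gives an orbit between \<open>U\<close> and
  \<open>V\<close> in one of the two directions, and its end point is periodic.\<close>

lemma disjoint_open_preimages:
  assumes x: "x \<in> Iso" and U: "open U" "U \<noteq> {}" "U \<subseteq> f -` {x}"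
    and V: "open V" "V \<noteq> {}" "V \<subseteq> f -` {x}" and disj: "U \<inter> V = {}"
  shows "\<exists>w\<in>U \<union> V. periodic_point f w"
proof -
  \<comment> \<open>The passage takes \<open>n > 0\<close> steps and its first step leads to
    \<open>x\<close>, so it ends in \<open>(f ^^ (n - 1)) x\<close>. That point maps to
    \<open>x\<close> again, so \<open>f ^^ n\<close> fixes \<open>x\<close> and the end point lies
    on the cycle of \<open>x\<close>.\<close>
  have aux: "periodic_point f ((f ^^ n) u)"
    if "u \<in> A" "(f ^^ n) u \<in> B" "A \<inter> B = {}" "A \<subseteq> f -` {x}" "B \<subseteq> f -` {x}" for A B u n
  proof -
    have "n > 0" using that by (cases n) auto
    then have fn: "(f ^^ n) u = (f ^^ (n - 1)) x"
      using that by (cases n) (auto simp: funpow_Suc_right simp del: funpow.simps)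
    moreover have "(f ^^ n) x = x"
    proof -
      have "(f ^^ n) x = f ((f ^^ (n - 1)) x)" using \<open>n > 0\<close> by (cases n) auto
      also have "\<dots> = x" using fn that by auto
      finally show ?thesis .
    qed
    ultimately show ?thesis
      using \<open>n > 0\<close> periodic_point_funpow[of f x] by (auto simp: periodic_point_def)
  qed
  from U(1,2) V(1,2) show ?thesis
  proof (cases rule: transitiveE)
    case (1 n u)
    then show ?thesis using aux[of u U n V] U V disj by blast
  next
    case (2 n v)
    then show ?thesis using aux[of v V n U] U V disj by blast
  qed
qed

text \<open>Both points are the last one before \<open>f a\<close> on the cycle of
  \<open>f a\<close>.\<close>

lemma periodic_preimage_unique:
  assumes "periodic_point f a" "periodic_point f b" "f a = f b"
  shows "a = b"
proof -
  have "periodic_point f (f a)" using periodic_point_funpow[OF assms(1), of 1] by simp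
  from minimal_period_exists[OF this] obtain l where l: "minimal_period f (f a) l" ..
  show ?thesis
    using periodic_predecessor[OF l assms(1)] periodic_predecessor[OF l assms(2)] assms(3) by simp
qed

text \<open>Hausdorff separation of \<open>a\<close> and \<open>b\<close>, with any periodic
  preimage removed, would leave two disjoint opene parts of the fibre without periodic
  points.\<close>

lemma nonperiodic_preimage_unique:
  assumes "x \<in> Iso" "a \<in> f -` {x}" "b \<in> f -` {x}" "\<not> periodic_point f a" "\<not> periodic_point f b"
  shows "a = b"
proof (rule ccontr)
  assume "a \<noteq> b"
  then obtain U V where UV: "open U" "open V" "a \<in> U" "b \<in> V" "U \<inter> V = {}"
    using hausdorff by metis
  \<comment> \<open>the only possible periodic preimage of \<open>x\<close>\<close>
  define C where "C = {c \<in> f -` {x}. periodic_point f c}"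
  have "finite C"
    using periodic_preimage_unique by (intro finite_if_all_equal) (auto simp: C_def)
  then have "open (f -` {x} - C)"
    using open_preimage[OF assms(1)] by (simp add: finite_imp_closed open_Diff)
  then have "open (U \<inter> (f -` {x} - C))" "open (V \<inter> (f -` {x} - C))" using UV by auto
  moreover have "a \<in> U \<inter> (f -` {x} - C)" "b \<in> V \<inter> (f -` {x} - C)"
    using assms UV by (auto simp: C_def)
  ultimately have "\<exists>w\<in>U \<inter> (f -` {x} - C) \<union> V \<inter> (f -` {x} - C). periodic_point f w"
    using UV(5) by (intro disjoint_open_preimages[OF assms(1)]) blast+
  then show False by (auto simp: C_def)
qed

text \<open>The fibre over \<open>x\<close> is open and has at most one periodic and one nonperiodic
  point; a finite open set in a Hausdorff space consists of isolated points.\<close>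

lemma preimage_isolated:
  assumes "x \<in> Iso" "f w = x"
  shows "w \<in> Iso"
proof -
  have "finite (f -` {x})"
  proof -
    have "finite {c \<in> f -` {x}. periodic_point f c}"
      using periodic_preimage_unique by (intro finite_if_all_equal) auto
    moreover have "finite {c \<in> f -` {x}. \<not> periodic_point f c}"
      using nonperiodic_preimage_unique[OF assms(1)] by (intro finite_if_all_equal) auto
    ultimately show ?thesis by (rule rev_finite_subset[OF finite_UnI]) blast
  qed
  then have "open (f -` {x} - (f -` {x} - {w}))"
    using open_preimage[OF assms(1)] by (intro open_Diff finite_imp_closed) auto
  also have "f -` {x} - (f -` {x} - {w}) = {w}" using assms by blast
  finally show ?thesis by (simp add: isolated_points_def)
qed

lemma iterated_preimage_isolated: "(f ^^ n) w \<in> Iso \<Longrightarrow> w \<in> Iso"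
  by (induction n arbitrary: w) (auto intro: preimage_isolated simp: funpow_swap1)

text \<open>Of two distinct preimages exactly one is periodic, as neither kind occurs twice;
  \<open>y\<close> is the other one, through which the cycle is entered. The last conclusion
  quantifies over \<open>l\<close> so that it can be matched with a period chosen elsewhere.\<close>

lemma two_preimages:
  assumes "x \<in> Iso" "has_two_preimages f x"
  obtains y where "y \<in> Iso" "f y = x" "\<not> periodic_point f y" "periodic_point f x"
    "\<And>l. minimal_period f x l \<Longrightarrow> f -` {x} = {y, (f ^^ (l - 1)) x}"
proof -
  obtain a b where ab: "a \<noteq> b" "f a = x" "f b = x"
    using assms(2) by (auto simp: has_two_preimages_def)
  have "periodic_point f a \<longleftrightarrow> \<not> periodic_point f b"
    using ab periodic_preimage_unique[of a b] nonperiodic_preimage_unique[OF assms(1), of a b]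
    by auto
  then obtain c y where cy: "periodic_point f c" "\<not> periodic_point f y" "f c = x" "f y = x"
    using ab by blast
  have per: "periodic_point f x" using periodic_point_funpow[OF cy(1), of 1] cy(3) by simp
  have "f -` {x} = {y, (f ^^ (l - 1)) x}" if "minimal_period f x l" for l
  proof
    show "f -` {x} \<subseteq> {y, (f ^^ (l - 1)) x}"
    proof
      fix w assume w: "w \<in> f -` {x}"
      show "w \<in> {y, (f ^^ (l - 1)) x}"
      proof (cases "periodic_point f w")
        case True
        then show ?thesis using periodic_predecessor[OF that True] w by simp
      next
        case False
        then show ?thesis using nonperiodic_preimage_unique[OF assms(1) w _ False, of y] cy by simp
      qed
    qed
    show "{y, (f ^^ (l - 1)) x} \<subseteq> f -` {x}"
      using cy(4) minimal_period_predecessor[OF that] by simp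
  qed
  then show thesis using that[OF preimage_isolated[OF assms(1) cy(4)] cy(4,2) per] by simp
qed

section \<open>Transitive points and the trichotomy of cases\<close>

lemma transitive_point_reaches_isolated:
  assumes "t \<in> transitive_points f" "x \<in> Iso"
  shows "\<exists>n. (f ^^ n) t = x"
  using open_singleton_mem_dense[of x "forward_orbit f t"] assms
  by (auto simp: transitive_points_def isolated_points_def mem_forward_orbit_iff)

text \<open>A point with dense orbit reaches an isolated point, so it is isolated itself as an
  iterated preimage. It also reaches its own preimage \<open>w\<close>, which is isolated too, and
  the next step closes a cycle.\<close>

lemma transitive_point_periodic:
  assumes "t \<in> transitive_points f" "\<forall>z\<in>Iso. f -` {z} \<noteq> {}"
  shows "t \<in> Iso \<and> periodic_point f t"
proof -
  obtain x where "x \<in> Iso" using isolated_nonempty by blast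
  then have t: "t \<in> Iso"
    using transitive_point_reaches_isolated[OF assms(1)] iterated_preimage_isolated by metis
  then obtain w where w: "f w = t" using assms(2) by blast
  then obtain n where "(f ^^ n) t = w"
    using transitive_point_reaches_isolated[OF assms(1)] preimage_isolated t by metis
  then have "(f ^^ Suc n) t = t" using w by simp
  then show ?thesis using t by (auto simp: periodic_point_def intro!: exI[of _ "Suc n"])
qed

text \<open>Comparability leaves at most one isolated point without preimage, so uniqueness in the
  first case is automatic; the rest is logic about empty, single and multiple preimages.\<close>

lemma case_split:
  "exactly_one_of (unique_isolated_without_preimage f)
    (isolated_preimages_nonempty_some_two f) (isolated_preimages_singletons f)"
proof -
  have uniq: "x = x'" if "x \<in> Iso" "x' \<in> Iso" "f -` {x} = {}" "f -` {x'} = {}" for x x'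
    using that(1,2)
  proof (cases rule: isolated_comparable)
    case (1 n)
    then show ?thesis using that(4) by (cases n) auto
  next
    case (2 n)
    then show ?thesis using that(3) by (cases n) auto
  qed
  have sing: "is_singleton A \<longleftrightarrow> A \<noteq> {} \<and> \<not> (\<exists>a b. a \<noteq> b \<and> {a, b} \<subseteq> A)" for A :: "'a set"
    by (auto intro!: is_singletonI' elim: is_singletonE)
  have "unique_isolated_without_preimage f \<longleftrightarrow> (\<exists>x\<in>Iso. f -` {x} = {})"
    unfolding unique_isolated_without_preimage_def using uniq by metis
  then show ?thesis
    unfolding exactly_one_of_def isolated_preimages_nonempty_some_two_def
      isolated_preimages_singletons_def sing has_two_preimages_def
    by blast
qed

section \<open>Recurrence and the single periodic orbit\<close>

text \<open>If there are other points, the opene set of all of them must reach \<open>x\<close>, so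
  \<open>x\<close> has a preimage. This preimage is isolated, so \<open>x\<close> must reach it,
  which closes a cycle.\<close>

lemma TT_plus_isolated_periodic:
  assumes "TT_plus f" "x \<in> Iso"
  shows "periodic_point f x"
proof (cases "UNIV = {x}")
  case True
  then have "(f ^^ 1) x = x" by blast
  then show ?thesis unfolding periodic_point_def by blast
next
  case False
  have hit: "\<exists>n. \<exists>u\<in>U. (f ^^ n) u \<in> V" if "open U" "U \<noteq> {}" "open V" "V \<noteq> {}" for U V
    using assms(1) that unfolding TT_plus_def opene_def
    by (metis all_not_in_conv hitting_times_plus_int_iff)
  have "open (- {x})" "- {x} \<noteq> {}" using False by auto
  then obtain n u where u: "u \<noteq> x" "(f ^^ n) u = x"
    using hit[of "- {x}" "{x}"] assms(2) by (auto simp: isolated_points_def)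
  then obtain m where "f ((f ^^ m) u) = x" by (cases n) auto
  moreover from this have "(f ^^ m) u \<in> Iso" using preimage_isolated assms(2) by blast
  then obtain j where "(f ^^ j) x = (f ^^ m) u"
    using hit[of "{x}" "{(f ^^ m) u}"] assms(2) by (auto simp: isolated_points_def)
  ultimately have "(f ^^ Suc j) x = x" by simp
  then show ?thesis unfolding periodic_point_def by blast
qed

text \<open>Every tail of the orbit of \<open>z\<close> is dense and so contains the isolated point
  \<open>x\<close>; visits at two different times give a period.\<close>

lemma DO_plusplus_isolated_periodic:
  assumes "DO_plusplus f" "x \<in> Iso"
  shows "periodic_point f x"
proof -
  obtain z where z: "omega_limit f z = UNIV" using assms(1) by (auto simp: DO_plusplus_def)
  have "\<exists>k\<ge>n. (f ^^ k) z = x" for n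
  proof -
    have "closure {(f ^^ k) z | k. k \<ge> n} = UNIV" using z by (auto simp: omega_limit_def)
    then have "x \<in> {(f ^^ k) z | k. k \<ge> n}"
      using open_singleton_mem_dense assms(2) by (auto simp: isolated_points_def)
    then show ?thesis by blast
  qed
  then obtain k k' where "(f ^^ k) z = x" "k' \<ge> Suc k" "(f ^^ k') z = x" by metis
  then show ?thesis using funpow_eq_imp_periodic[of k f z k'] by simp
qed

text \<open>With unique preimages the cycle of \<open>x\<close> contains all its preimages, so the
  full orbit is this finite, hence closed, set; being dense it is the whole space.\<close>

lemma single_periodic_orbitI:
  assumes sing: "isolated_preimages_singletons f" and x: "x \<in> Iso" "periodic_point f x"
  shows "is_single_periodic_orbit_system f"
proof -
  let ?orb = "forward_orbit f x"
  have reach: "\<exists>m. (f ^^ m) v = x" if "v \<in> ?orb" for v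
    using that periodic_point_reaches_back[OF x(2)] by (auto simp: mem_forward_orbit_iff)
  have step: "w \<in> ?orb" if w: "f w \<in> ?orb" for w
  proof -
    obtain n where n: "f w = (f ^^ n) x" using w by (auto simp: mem_forward_orbit_iff)
    have iso: "f w \<in> Iso" using reach[OF w] iterated_preimage_isolated x(1) by metis
    have "periodic_point f (f w)" using n periodic_point_funpow[OF x(2)] by simp
    from minimal_period_exists[OF this] obtain l where l: "minimal_period f (f w) l" ..
    have "is_singleton (f -` {f w})"
      using sing iso unfolding isolated_preimages_singletons_def by blast
    \<comment> \<open>The cyclic predecessor of \<open>f w\<close> is one preimage, hence the only
      one.\<close>
    then have "w = (f ^^ (l - 1)) (f w)"
      using minimal_period_predecessor[OF l] by (metis is_singletonE singletonD vimage_singleton_eq)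
    then show ?thesis unfolding n funpow_funpow mem_forward_orbit_iff by blast
  qed
  have pull: "v \<in> ?orb" if "(f ^^ n) v \<in> ?orb" for n v
    using that
  proof (induction n arbitrary: v)
    case (Suc n)
    then have "f v \<in> ?orb" by (simp add: funpow_swap1)
    then show ?case by (rule step)
  qed simp
  have "x \<in> ?orb" by (auto simp: mem_forward_orbit_iff intro: exI[of _ 0])
  then have "full_orbit f x = ?orb" using pull by (auto simp: mem_full_orbit_iff)
  then have univ: "?orb = UNIV"
    using full_orbit_dense[OF x(1)] finite_forward_orbit_periodic[OF x(2)]
    by (simp add: finite_imp_closed)
  have iso: "Iso = UNIV" using reach univ iterated_preimage_isolated x(1) by blast
  have "forward_orbit f v = UNIV" for v
  proof -
    obtain m where m: "(f ^^ m) v = x" using reach univ by blast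
    have "\<exists>n. w = (f ^^ n) v" for w
    proof -
      obtain k where "w = (f ^^ k) ((f ^^ m) v)"
        using univ m by (metis UNIV_I mem_forward_orbit_iff)
      then show ?thesis unfolding funpow_funpow by blast
    qed
    then show ?thesis by (auto simp: mem_forward_orbit_iff)
  qed
  then have "transitive_points f = UNIV" by (simp add: transitive_points_def)
  moreover have "\<exists>w. f w = v" for v
  proof -
    have "is_singleton (f -` {v})" using sing iso unfolding isolated_preimages_singletons_def by blast
    then show ?thesis by (metis is_singletonE singletonI vimage_singleton_eq)
  qed
  then have "range f = UNIV" by (metis surj_def)
  ultimately show ?thesis
    using iso univ x(2) unfolding is_single_periodic_orbit_system_def by blast
qed

text \<open>A periodic point has a preimage. Preimages of isolated points are isolated and therefore
  periodic here, and \<open>f\<close> is injective on periodic points, so no branching is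
  possible.\<close>

lemma all_isolated_periodicI:
  assumes per: "\<And>x. x \<in> Iso \<Longrightarrow> periodic_point f x"
  shows "isolated_preimages_singletons f \<and> is_single_periodic_orbit_system f"
proof -
  have "is_singleton (f -` {x})" if x: "x \<in> Iso" for x
  proof (rule is_singletonI')
    show "f -` {x} \<noteq> {}" by (rule periodic_point_preimage[OF per[OF x]])
    show "a = b" if "a \<in> f -` {x}" "b \<in> f -` {x}" for a b
    proof -
      have "f a = x" "f b = x" using that by simp_all
      then have "a \<in> Iso" "b \<in> Iso" using preimage_isolated[OF x] by blast+
      then show ?thesis
        using periodic_preimage_unique[OF per per] \<open>f a = x\<close> \<open>f b = x\<close> by metis
    qed
  qed
  then have "isolated_preimages_singletons f" by (simp add: isolated_preimages_singletons_def)
  moreover obtain x where "x \<in> Iso" using isolated_nonempty by blast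
  ultimately show ?thesis using single_periodic_orbitI per by blast
qed

lemma single_periodic_orbit_recurrence:
  assumes "is_single_periodic_orbit_system f"
  shows "TT_plusplus f" "DO_plusplus f"
proof -
  obtain x where x: "periodic_point f x" "forward_orbit f x = UNIV"
    using assms by (auto simp: is_single_periodic_orbit_system_def)
  have per: "periodic_point f u" for u
    using x periodic_point_funpow[OF x(1)] by (metis UNIV_I mem_forward_orbit_iff)
  \<comment> \<open>Visits from \<open>u\<close> to \<open>v\<close> recur along an arithmetic
    progression whose difference is a period of \<open>u\<close>; this serves both claims.\<close>
  have visits: "\<exists>n l. l > 0 \<and> (\<forall>m. (f ^^ (n + l * m)) u = v)" for u v
  proof -
    obtain m where m: "(f ^^ m) u = x"
      using x periodic_point_reaches_back[OF x(1)] by (metis UNIV_I mem_forward_orbit_iff)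
    obtain k where "v = (f ^^ k) x" using x by (metis UNIV_I mem_forward_orbit_iff)
    then have n: "(f ^^ (k + m)) u = v" using m by (simp flip: funpow_funpow)
    obtain l where l: "l > 0" "(f ^^ l) u = u" using per by (auto simp: periodic_point_def)
    have "(f ^^ (k + m + l * j)) u = v" for j
      using n funpow_multiple_period[OF l(2)] by (metis funpow_funpow)
    then show ?thesis using l(1) by blast
  qed
  show "TT_plusplus f"
    unfolding TT_plusplus_def
  proof (intro allI impI)
    fix U V :: "'a set" assume "opene U \<and> opene V"
    then obtain u v where uv: "u \<in> U" "v \<in> V" by (auto simp: opene_def)
    obtain n l where nl: "l > 0" "\<And>m. (f ^^ (n + l * m)) u = v" using visits by metis
    have "range (\<lambda>m. int (n + l * m)) \<subseteq> hitting_times_plus f U V"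
      using nl(2) uv
      by (auto simp: hitting_times_plus_int_iff simp del: of_nat_add of_nat_mult intro!: bexI[of _ u])
    moreover have "infinite (range (\<lambda>m. int (n + l * m)))"
      using nl(1) by (intro range_inj_infinite injI) simp
    ultimately show "infinite (hitting_times_plus f U V)" using finite_subset by blast
  qed
  have "v \<in> closure {(f ^^ k) x | k. k \<ge> n}" for v n
  proof -
    obtain m l where ml: "l > 0" "\<And>j. (f ^^ (m + l * j)) x = v" using visits by metis
    \<comment> \<open>Taking \<open>j = n\<close> makes the visiting time at least \<open>n\<close>,
      since \<open>l > 0\<close>.\<close>
    have "m + l * n \<ge> n" using ml(1) by (simp add: trans_le_add2)
    then have "v \<in> {(f ^^ k) x | k. k \<ge> n}" using ml(2)[of n] by blast
    then show ?thesis by (rule closure_subset[THEN subsetD])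
  qed
  then have "omega_limit f x = UNIV" by (auto simp: omega_limit_def)
  then show "DO_plusplus f" unfolding DO_plusplus_def by blast
qed

text \<open>Each property makes all isolated points periodic, which forces a single periodic orbit;
  such a system in turn has both \<open>TT_plusplus\<close> and \<open>DO_plusplus\<close>.\<close>

lemma recurrence_iff_single_periodic_orbit:
  "TT_plusplus f \<longleftrightarrow> isolated_preimages_singletons f \<and> is_single_periodic_orbit_system f"
  "TT_plus f \<longleftrightarrow> isolated_preimages_singletons f \<and> is_single_periodic_orbit_system f"
  "DO_plusplus f \<longleftrightarrow> isolated_preimages_singletons f \<and> is_single_periodic_orbit_system f"
  by (metis all_isolated_periodicI single_periodic_orbit_recurrence TT_plusplus_imp_TT_plus
      TT_plus_isolated_periodic DO_plusplus_isolated_periodic)+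

section \<open>Case 1: an isolated point without preimage\<close>

text \<open>Only \<open>x\<close> itself ever arrives at \<open>x\<close>, at time \<open>0\<close>.
  Hence the full orbit has no further backward part, a transitive point equals \<open>x\<close>, and
  \<open>{x}\<close> is an open set missed by the range; as \<open>x\<close> is not periodic, the
  recurrence properties fail.\<close>

lemma initial_point:
  assumes x: "x \<in> Iso" "f -` {x} = {}"
  shows "Iso \<subseteq> forward_orbit f x" "full_orbit f x = forward_orbit f x"
    "closure (forward_orbit f x) = UNIV" "transitive_points f = {x}" "closure (range f) \<noteq> UNIV"
    "DO_plus f" "\<not> TT_plus f" "\<not> TT_plusplus f" "\<not> DO_plusplus f"
proof -
  have "x \<in> forward_orbit f x" by (auto simp: mem_forward_orbit_iff intro: exI[of _ 0])
  then have "v \<in> forward_orbit f x" if "(f ^^ n) v = x" for n v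
    using no_preimage_funpow[OF x(2) that] by simp
  then show full: "full_orbit f x = forward_orbit f x"
    unfolding set_eq_iff mem_full_orbit_iff by blast
  show "Iso \<subseteq> forward_orbit f x" using isolated_subset_full_orbit[OF x(1)] full by simp
  show dense: "closure (forward_orbit f x) = UNIV" using full_orbit_dense[OF x(1)] full by simp
  show trans: "transitive_points f = {x}"
  proof
    show "{x} \<subseteq> transitive_points f" using dense by (simp add: transitive_points_def)
    show "transitive_points f \<subseteq> {x}"
      using transitive_point_reaches_isolated[OF _ x(1)] no_preimage_funpow[OF x(2)] by blast
  qed
  show "DO_plus f" using trans by (simp add: DO_plus_def)
  show "closure (range f) \<noteq> UNIV"
    using open_singleton_mem_dense[of x "range f"] x by (auto simp: isolated_points_def)
  have "\<not> periodic_point f x" using x(2) periodic_point_preimage[of f x] by blast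
  then show "\<not> TT_plus f" "\<not> DO_plusplus f"
    using TT_plus_isolated_periodic DO_plusplus_isolated_periodic x(1) by blast+
  then show "\<not> TT_plusplus f" using TT_plusplus_imp_TT_plus by blast
qed

text \<open>Either the orbit of \<open>x\<close> stays in \<open>Iso\<close>, without repetition
  (\<open>?A\<close>) or running into a cycle (\<open>?B\<close>), or it leaves \<open>Iso\<close>
  for good (\<open>?C\<close>). Finiteness of \<open>Iso\<close> and of the space keeps the
  alternatives apart.\<close>

lemma initial_point_subcases:
  assumes x: "x \<in> Iso" "f -` {x} = {}"
  shows "exactly_one_of
          (Iso = full_orbit f x \<and> full_orbit f x = forward_orbit f x \<and>
           infinite Iso \<and> inj (\<lambda>k. (f ^^ k) x) \<and> closure Iso = UNIV)
          (Iso = full_orbit f x \<and> full_orbit f x = forward_orbit f x \<and>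
           forward_orbit f x = UNIV \<and> finite Iso \<and>
           (\<exists>k l y. k > 0 \<and> y = (f ^^ k) x \<and>
              periodic_point f y \<and> (\<forall>j<k. \<not> periodic_point f ((f ^^ j) x)) \<and>
              preperiodic_orbit f (forward_orbit f x) y l \<and>
              f -` {y} = {(f ^^ (k - 1)) x, (f ^^ (l - 1)) y}))
          ((\<exists>n::nat. Iso = (\<lambda>k. (f ^^ k) x) ` {..<n} \<and>
              inj_on (\<lambda>k. (f ^^ k) x) {..<n} \<and> (\<forall>k\<ge>n. (f ^^ k) x \<notin> Iso)) \<and>
           infinite (UNIV :: 'a set) \<and> finite Iso \<and> closure Iso \<noteq> UNIV \<and>
           forward_orbit f x = full_orbit f x \<and> closure (forward_orbit f x) = UNIV)"
    (is "exactly_one_of ?A ?B ?C")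
proof -
  note init = initial_point[OF x]
  have not_per: "\<not> periodic_point f x" using x(2) periodic_point_preimage[of f x] by blast
  have eventually_periodic: "\<exists>k. periodic_point f ((f ^^ k) x)" if "\<not> inj (\<lambda>k. (f ^^ k) x)"
    using that funpow_eq_imp_periodic[of _ f x] by (metis linorder_injI)
  have "?A \<or> ?B \<or> ?C"
  proof (cases "\<forall>k. (f ^^ k) x \<in> Iso")
    case True
    then have iso: "Iso = forward_orbit f x" using init(1) by (auto simp: mem_forward_orbit_iff)
    show ?thesis
    proof (cases "inj (\<lambda>k. (f ^^ k) x)")
      case True
      then have "infinite Iso" unfolding iso forward_orbit_def by (rule range_inj_infinite)
      then show ?thesis using True iso init by simp
    next
      case False
      \<comment> \<open>The first time at which the orbit is periodic: the point before it is not,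
        and so is a second preimage of \<open>y\<close> beside the cyclic predecessor.\<close>
      define k where "k = (LEAST k. periodic_point f ((f ^^ k) x))"
      define y where "y = (f ^^ k) x"
      have y: "periodic_point f y"
        unfolding y_def k_def using eventually_periodic[OF False] by (rule LeastI_ex)
      have least: "\<not> periodic_point f ((f ^^ j) x)" if "j < k" for j
        using that not_less_Least unfolding k_def by blast
      have k: "k > 0" using y not_per unfolding y_def by (cases k) auto
      obtain l where l: "minimal_period f y l" using minimal_period_exists[OF y] by blast
      have "f ((f ^^ (k - 1)) x) = y" using k unfolding y_def by (cases k) auto
      moreover have "f ((f ^^ (l - 1)) y) = y" by (rule minimal_period_predecessor[OF l])
      moreover have "\<not> periodic_point f ((f ^^ (k - 1)) x)" using least k by simp
      moreover have "periodic_point f ((f ^^ (l - 1)) y)" by (rule periodic_point_funpow[OF y])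
      ultimately have two: "(f ^^ (k - 1)) x \<noteq> (f ^^ (l - 1)) y"
          "{(f ^^ (k - 1)) x, (f ^^ (l - 1)) y} \<subseteq> f -` {y}" by auto
      then have "has_two_preimages f y" unfolding has_two_preimages_def by blast
      moreover have "y \<in> Iso" using True y_def by simp
      ultimately obtain y' where y': "f -` {y} = {y', (f ^^ (l - 1)) y}"
        using two_preimages l by metis
      have pre: "f -` {y} = {(f ^^ (k - 1)) x, (f ^^ (l - 1)) y}"
        using y' two by auto
      \<comment> \<open>Pre-periodicity asks for an orbit that differs from the cycle, as
        \<open>x\<close> witnesses, and for an index of entry, which is \<open>k\<close>.\<close>
      have "x \<notin> forward_orbit f y"
        using periodic_point_funpow[OF y] not_per by (auto simp: mem_forward_orbit_iff)
      moreover have "x \<in> forward_orbit f x"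
        by (auto simp: mem_forward_orbit_iff intro: exI[of _ 0])
      moreover note forward_orbit_sequence[OF x(2)]
      moreover have "(f ^^ nat i) x \<in> forward_orbit f y" if "i \<ge> int k" for i
      proof -
        have "(f ^^ nat i) x = (f ^^ (nat i - k)) y"
          using that unfolding y_def funpow_funpow by simp
        then show ?thesis unfolding mem_forward_orbit_iff by blast
      qed
      ultimately have prep: "preperiodic_orbit f (forward_orbit f x) y l"
        unfolding preperiodic_orbit_def using l
        by (intro conjI exI[of _ "{0..}"] exI[of _ "\<lambda>i. (f ^^ nat i) x"] bexI[of _ "int k"]) auto
      \<comment> \<open>Transient part plus cycle: the orbit is finite, hence closed, and density
        makes it the whole space.\<close>
      have "forward_orbit f x \<subseteq> (\<lambda>j. (f ^^ j) x) ` {..<k} \<union> forward_orbit f y"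
      proof
        fix v assume "v \<in> forward_orbit f x"
        then obtain j where j: "v = (f ^^ j) x" by (auto simp: mem_forward_orbit_iff)
        show "v \<in> (\<lambda>j. (f ^^ j) x) ` {..<k} \<union> forward_orbit f y"
        proof (cases "j < k")
          case False
          then have "v = (f ^^ (j - k)) y" unfolding j y_def funpow_funpow by simp
          then have "v \<in> forward_orbit f y" unfolding mem_forward_orbit_iff by blast
          then show ?thesis by blast
        qed (use j in blast)
      qed
      then have fin: "finite (forward_orbit f x)"
        using finite_forward_orbit_periodic[OF y] finite_subset by blast
      then have univ: "forward_orbit f x = UNIV" using init(3) by (simp add: finite_imp_closed)
      have "k > 0 \<and> y = (f ^^ k) x \<and>
          periodic_point f y \<and> (\<forall>j<k. \<not> periodic_point f ((f ^^ j) x)) \<and>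
          preperiodic_orbit f (forward_orbit f x) y l \<and>
          f -` {y} = {(f ^^ (k - 1)) x, (f ^^ (l - 1)) y}"
        using k y_def y least prep pre by blast
      then have ?B using fin univ iso init(2) by metis
      then show ?thesis by blast
    qed
  next
    case False
    define n where "n = (LEAST n. (f ^^ n) x \<notin> Iso)"
    from False have "\<exists>n. (f ^^ n) x \<notin> Iso" by simp
    then have n: "(f ^^ n) x \<notin> Iso" unfolding n_def by (rule LeastI_ex)
    have below: "(f ^^ k) x \<in> Iso" if "k < n" for k
      using that not_less_Least unfolding n_def by blast
    \<comment> \<open>An iterated preimage of an isolated point is isolated, so the orbit cannot
      return to \<open>Iso\<close>.\<close>
    have above: "(f ^^ k) x \<notin> Iso" if "k \<ge> n" for k
    proof -
      have "(f ^^ k) x = (f ^^ (k - n)) ((f ^^ n) x)" using that by (simp add: funpow_funpow)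
      then show ?thesis using n iterated_preimage_isolated by metis
    qed
    have iso: "Iso = (\<lambda>k. (f ^^ k) x) ` {..<n}"
    proof
      show "Iso \<subseteq> (\<lambda>k. (f ^^ k) x) ` {..<n}"
      proof
        fix z assume z: "z \<in> Iso"
        then obtain k where "z = (f ^^ k) x"
          using subsetD[OF init(1)] unfolding mem_forward_orbit_iff by metis
        then show "z \<in> (\<lambda>k. (f ^^ k) x) ` {..<n}" using z above by (cases "k < n") auto
      qed
    qed (use below in blast)
    have "inj_on (\<lambda>k. (f ^^ k) x) {..<n}"
    proof (rule linorder_inj_onI)
      fix i j assume ij: "i < j" "i \<in> {..<n}" "j \<in> {..<n}"
      show "(f ^^ i) x \<noteq> (f ^^ j) x"
      proof
        assume eq: "(f ^^ i) x = (f ^^ j) x"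
        \<comment> \<open>A repetition would show the exit point already at time
          \<open>n - j + i\<close>, before the first exit.\<close>
        have "(f ^^ (n - j + i)) x = (f ^^ (n - j)) ((f ^^ i) x)" by (simp add: funpow_funpow)
        also have "\<dots> = (f ^^ n) x" using ij eq by (simp add: funpow_funpow)
        finally have "(f ^^ (n - j + i)) x \<notin> Iso" using n by simp
        moreover have "n - j + i < n" using ij by auto
        ultimately show False using below by blast
      qed
    qed auto
    moreover have fin: "finite Iso" unfolding iso by simp
    moreover have "closure Iso \<noteq> UNIV" using fin n by (auto simp: finite_imp_closed)
    \<comment> \<open>A finite Hausdorff space is discrete, but the exit point is not
      isolated.\<close>
    moreover have "infinite (UNIV :: 'a set)"
    proof
      assume "finite (UNIV :: 'a set)"
      then have "finite (- {(f ^^ n) x})" by (rule finite_subset[OF subset_UNIV])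
      then have "closed (- {(f ^^ n) x})" by (rule finite_imp_closed)
      then have "open {(f ^^ n) x}" unfolding closed_def by simp
      then show False using n by (simp add: isolated_points_def)
    qed
    ultimately have ?C using iso above init(2,3) by metis
    then show ?thesis by blast
  qed
  moreover have "\<not> (?A \<and> ?B)" "\<not> (?A \<and> ?C)" by blast+
  moreover have "\<not> (?B \<and> ?C)"
  proof
    assume "?B \<and> ?C"
    then have "Iso = UNIV" by (elim conjE) metis
    moreover have "finite Iso" "infinite (UNIV :: 'a set)" using \<open>?B \<and> ?C\<close> by blast+
    ultimately show False by simp
  qed
  ultimately show ?thesis unfolding exactly_one_of_def by argo
qed

lemma initial_point_dense_orbit:
  assumes x: "x \<in> Iso" "f -` {x} = {}"
  shows "has_dense_orbit f"
proof -
  have "is_orbit f (forward_orbit f x)"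
    using forward_orbit_sequence[OF x(2)] unfolding is_orbit_def by blast
  then show ?thesis using initial_point(3)[OF x] unfolding has_dense_orbit_def by blast
qed

section \<open>Isolated points that all have preimages, and Case 2: a branch point\<close>

lemma isolated_subset_range:
  assumes "\<forall>z\<in>Iso. f -` {z} \<noteq> {}"
  shows "Iso \<subseteq> range f"
proof
  fix z assume "z \<in> Iso"
  then obtain w where "f w = z" using assms by blast
  then show "z \<in> range f" by blast
qed

text \<open>Points leading to \<open>x\<close> are isolated as iterated preimages, those ahead of it
  by assumption.\<close>

lemma full_orbit_eq_isolated:
  assumes "x \<in> Iso" "\<And>n. (f ^^ n) x \<in> Iso"
  shows "full_orbit f x = Iso"
proof
  show "full_orbit f x \<subseteq> Iso"
  proof
    fix v assume "v \<in> full_orbit f x"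
    then consider n where "v = (f ^^ n) x" | n where "(f ^^ n) v = x"
      by (auto simp: mem_full_orbit_iff mem_forward_orbit_iff)
    then show "v \<in> Iso"
      by cases (use assms iterated_preimage_isolated in metis)+
  qed
qed (rule isolated_subset_full_orbit[OF assms(1)])

text \<open>A transitive point would be periodic and would reach \<open>y\<close>, making
  \<open>y\<close> periodic.\<close>

lemma nonperiodic_no_transitive_points:
  assumes "y \<in> Iso" "\<not> periodic_point f y" "\<forall>z\<in>Iso. f -` {z} \<noteq> {}"
  shows "transitive_points f = {}"
proof (rule ccontr)
  assume "transitive_points f \<noteq> {}"
  then obtain t where t: "t \<in> transitive_points f" by blast
  then obtain n where "(f ^^ n) t = y" using transitive_point_reaches_isolated assms(1) by blast
  moreover have "periodic_point f t" using transitive_point_periodic[OF t assms(3)] by blast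
  ultimately show False using periodic_point_funpow[of f t n] assms(2) by simp
qed

text \<open>Each branch point is entered from a nonperiodic isolated point. One of two such entries
  reaches the other, but the step after an entry leads into a cycle, which is never left, so the
  entries coincide.\<close>

lemma branch_point_unique:
  assumes "x \<in> Iso" "has_two_preimages f x" "x' \<in> Iso" "has_two_preimages f x'"
  shows "x = x'"
proof -
  obtain y where y: "y \<in> Iso" "f y = x" "\<not> periodic_point f y" "periodic_point f x"
    using two_preimages[OF assms(1,2)] by metis
  obtain y' where y': "y' \<in> Iso" "f y' = x'" "\<not> periodic_point f y'" "periodic_point f x'"
    using two_preimages[OF assms(3,4)] by metis
  have enters: "b = a" if "(f ^^ n) a = b" "periodic_point f (f a)" "\<not> periodic_point f b" for a b n
    using that periodic_point_funpow[OF that(2), of "n - 1"]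
    by (cases n) (auto simp: funpow_swap1)
  from y(1) y'(1) have "y = y'"
    by (rule isolated_comparable) (use enters y y' in metis)+
  then show ?thesis using y(2) y'(2) by simp
qed

text \<open>The orbit is traced from \<open>y\<close>, the last point before the cycle, instead of
  from \<open>x\<close>: no point leading to \<open>y\<close> is periodic, so none is a branch
  point, and the bi-infinite sequence through \<open>y\<close> is determined.\<close>

lemma branch_point:
  assumes x: "x \<in> Iso" "has_two_preimages f x" and nonempty: "\<forall>z\<in>Iso. f -` {z} \<noteq> {}"
  shows "Iso = full_orbit f x \<and> infinite Iso \<and>
        (\<exists>l y. preperiodic_orbit f (full_orbit f x) x l \<and>
           f -` {x} = {y, (f ^^ (l - 1)) x} \<and>
           (\<forall>k::nat. \<exists>z\<in>Iso. iter_image f (- int k) {y} = {z}))"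
    and "is_orbit f Iso" "transitive_points f = {}"
proof -
  obtain y where y: "y \<in> Iso" "f y = x" "\<not> periodic_point f y" "periodic_point f x"
    and pre: "\<And>l. minimal_period f x l \<Longrightarrow> f -` {x} = {y, (f ^^ (l - 1)) x}"
    using two_preimages[OF x] by metis
  show "transitive_points f = {}" by (rule nonperiodic_no_transitive_points[OF y(1,3) nonempty])
  have sing: "\<forall>v n. (f ^^ n) v = y \<longrightarrow> is_singleton (f -` {v})"
  proof (intro allI impI)
    fix v n assume v: "(f ^^ n) v = y"
    then have "\<not> periodic_point f v" using periodic_point_funpow[of f v n] y(3) by auto
    then have "v \<noteq> x" using y(4) by auto
    moreover have iso: "v \<in> Iso" using v y(1) iterated_preimage_isolated by metis
    ultimately have "\<not> has_two_preimages f v" using branch_point_unique[OF x] by blast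
    then show "is_singleton (f -` {v})"
      using nonempty iso by (intro is_singletonI') (auto simp: has_two_preimages_def)
  qed
  obtain z where z: "\<And>k. {v. (f ^^ k) v = y} = {z k}"
    using iterated_preimages_singleton[OF sing] by blast
  have fz: "(f ^^ k) (z k) = y" for k using z[of k] by blast
  then have z_iso: "z k \<in> Iso" for k using iterated_preimage_isolated y(1) by metis
  have forward: "(f ^^ n) x \<in> Iso" for n
    using periodic_point_reaches_back[OF y(4), of n] iterated_preimage_isolated x(1) by metis
  have iso_x: "Iso = full_orbit f x" using full_orbit_eq_isolated[OF x(1) forward] by simp
  have forward_y: "(f ^^ n) y \<in> Iso" for n
    using forward y(1,2) by (cases n) (auto simp: funpow_swap1)
  have iso_y: "Iso = full_orbit f y" using full_orbit_eq_isolated[OF y(1) forward_y] by simp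
  obtain s where s: "orbit_sequence f UNIV s" "range s = full_orbit f y"
      "\<forall>k\<ge>0. s k = (f ^^ nat k) y"
    using full_orbit_bi_infinite[OF sing] by blast
  then show "is_orbit f Iso" unfolding is_orbit_def iso_y by metis
  \<comment> \<open>If \<open>z i = z j\<close> with \<open>i < j\<close>, this point would arrive
    at \<open>y\<close> at two different times, making \<open>y\<close> periodic.\<close>
  have "inj z"
  proof (rule linorder_injI)
    fix i j :: nat assume "i < j"
    then show "z i \<noteq> z j" using fz funpow_eq_imp_periodic[of i f "z i" j] y(3) by metis
  qed
  then have "infinite Iso"
    using z_iso finite_subset[of "range z" Iso] range_inj_infinite by blast
  obtain l where l: "minimal_period f x l" using minimal_period_exists[OF y(4)] by blast
  have "y \<notin> forward_orbit f x"
    using periodic_point_funpow[OF y(4)] y(3) by (auto simp: mem_forward_orbit_iff)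
  then have "full_orbit f x \<noteq> forward_orbit f x" using y(1) iso_x by blast
  \<comment> \<open>Index \<open>0\<close> is \<open>y\<close> and index \<open>1\<close> is
    \<open>x\<close>, so the cycle is entered at index \<open>1\<close>.\<close>
  moreover have "s k \<in> forward_orbit f x" if "k \<ge> 1" for k
  proof -
    have "nat k = Suc (nat k - 1)" using that by simp
    then have "s k = (f ^^ (nat k - 1)) x"
      using s(3) that y(2) by (metis comp_apply funpow_Suc_right order_trans zero_le_one)
    then show ?thesis unfolding mem_forward_orbit_iff by blast
  qed
  ultimately have "preperiodic_orbit f (full_orbit f x) x l"
    unfolding preperiodic_orbit_def using l s(1,2) iso_x iso_y by blast
  then show "Iso = full_orbit f x \<and> infinite Iso \<and>
        (\<exists>l y. preperiodic_orbit f (full_orbit f x) x l \<and>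
           f -` {x} = {y, (f ^^ (l - 1)) x} \<and>
           (\<forall>k::nat. \<exists>z\<in>Iso. iter_image f (- int k) {y} = {z}))"
    using iso_x \<open>infinite Iso\<close> pre[OF l] z z_iso unfolding iter_image_minus_int_singleton by blast
qed

section \<open>Case 3: every isolated point has exactly one preimage\<close>

lemma singleton_preimages_iterated:
  assumes "isolated_preimages_singletons f" "p \<in> Iso"
  shows "\<forall>v n. (f ^^ n) v = p \<longrightarrow> is_singleton (f -` {v})"
  using assms iterated_preimage_isolated unfolding isolated_preimages_singletons_def by metis

text \<open>Outside \<open>?A\<close> no isolated point is periodic. Then either \<open>f\<close>
  maps \<open>Iso\<close> into itself, giving \<open>?B\<close>, or the chain has an exit point,
  giving \<open>?C\<close>. Existence of transitive points sets \<open>?A\<close> apart; an exit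
  point separates \<open>?C\<close> from \<open>?B\<close>.\<close>

lemma singleton_preimages_subcases:
  assumes sing: "isolated_preimages_singletons f"
  shows "exactly_one_of
        (is_single_periodic_orbit_system f)
        ((\<forall>x\<in>Iso. full_orbit f x = Iso \<and>
            (\<exists>s. orbit_sequence f UNIV s \<and> range s = full_orbit f x)) \<and>
         transitive_points f = {} \<and> closure Iso = UNIV \<and> closure (range f) = UNIV)
        ((\<exists>!y. y \<in> Iso \<and> f y \<notin> Iso) \<and>
         (\<forall>y\<in>Iso. f y \<notin> Iso \<longrightarrow>
            (\<exists>s::nat \<Rightarrow> 'a. s 0 = y \<and> inj s \<and>
               (\<forall>k. iter_image f (- int k) {y} = {s k}) \<and> Iso = range s) \<and>
            (\<forall>k>0. (f ^^ k) y \<notin> Iso)) \<and>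
         transitive_points f = {} \<and> closure (range f) = UNIV)"
    (is "exactly_one_of ?A ?B ?C")
proof -
  have nonempty: "\<forall>z\<in>Iso. f -` {z} \<noteq> {}"
    using sing unfolding isolated_preimages_singletons_def is_singleton_def by blast
  obtain p where p: "p \<in> Iso" using isolated_nonempty by blast
  have "?A \<or> ?B \<or> ?C"
  proof (cases ?A)
    case False
    then have nonper: "\<not> periodic_point f x" if "x \<in> Iso" for x
      using single_periodic_orbitI[OF sing that] by blast
    have trans: "transitive_points f = {}"
      by (rule nonperiodic_no_transitive_points[OF p nonper[OF p] nonempty])
    have iso_range: "Iso \<subseteq> range f" by (rule isolated_subset_range[OF nonempty])
    \<comment> \<open>\<open>Iso\<close> need not be dense, so density of the range comes from the
      full orbit: each of its points is a proper iterate or an isolated point, and both have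
      preimages.\<close>
    have "full_orbit f p \<subseteq> range f"
    proof
      fix v assume "v \<in> full_orbit f p"
      then consider n where "v = (f ^^ n) p" | n where "(f ^^ n) v = p"
        by (auto simp: mem_full_orbit_iff mem_forward_orbit_iff)
      then show "v \<in> range f"
      proof cases
        case (1 n)
        then show ?thesis using iso_range p by (cases n) auto
      next
        case 2
        then show ?thesis using iterated_preimage_isolated p iso_range by blast
      qed
    qed
    then have dense: "closure (range f) = UNIV"
      using closure_mono full_orbit_dense[OF p] by blast
    show ?thesis
    proof (cases "\<forall>x\<in>Iso. f x \<in> Iso")
      case True
      have full: "full_orbit f x = Iso" if x: "x \<in> Iso" for x
      proof (rule full_orbit_eq_isolated[OF x])
        show "(f ^^ n) x \<in> Iso" for n using True x by (induction n) auto
      qed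
      moreover have "\<exists>s. orbit_sequence f UNIV s \<and> range s = full_orbit f x" if "x \<in> Iso" for x
        using full_orbit_bi_infinite[OF singleton_preimages_iterated[OF sing that]] by blast
      moreover have "closure Iso = UNIV" using full_orbit_dense[OF p] full[OF p] by simp
      ultimately have ?B using trans dense by blast
      then show ?thesis by blast
    next
      case False
      then obtain y where y: "y \<in> Iso" "f y \<notin> Iso" by blast
      \<comment> \<open>Leaving \<open>Iso\<close> is final, since iterated preimages of isolated
        points are isolated.\<close>
      have leaves: "(f ^^ k) w \<notin> Iso" if "f w \<notin> Iso" "k > 0" for w k
      proof
        assume "(f ^^ k) w \<in> Iso"
        moreover have "(f ^^ k) w = (f ^^ (k - 1)) (f w)"
          using that(2) by (cases k) (auto simp: funpow_swap1)
        ultimately show False using iterated_preimage_isolated that(1) by metis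
      qed
      \<comment> \<open>One of two exit points reaches the other, which can only happen in
        \<open>0\<close> steps.\<close>
      have unique: "w = y" if w: "w \<in> Iso" "f w \<notin> Iso" for w
        using w(1) y(1)
      proof (cases rule: isolated_comparable)
        case (1 n)
        then show ?thesis using leaves[OF w(2), of n] y(1) by (cases n) auto
      next
        case (2 n)
        then show ?thesis using leaves[OF y(2), of n] w(1) by (cases n) auto
      qed
      obtain s where s: "s 0 = y" "\<And>k. {v. (f ^^ k) v = y} = {s k}"
        using iterated_preimages_singleton[OF singleton_preimages_iterated[OF sing y(1)]] by blast
      have fs: "(f ^^ k) (s k) = y" for k using s(2)[of k] by blast
      have "inj s"
      proof (rule linorder_injI)
        fix i j :: nat assume "i < j"
        then show "s i \<noteq> s j"
          using fs funpow_eq_imp_periodic[of i f "s i" j] nonper[OF y(1)] by metis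
      qed
      moreover have "Iso = range s"
      proof
        show "range s \<subseteq> Iso" using fs iterated_preimage_isolated y(1) by (metis image_subsetI)
        show "Iso \<subseteq> range s"
        proof
          fix v assume v: "v \<in> Iso"
          \<comment> \<open>After its first step \<open>y\<close> meets no isolated point, so
            comparability makes \<open>v\<close> reach \<open>y\<close>.\<close>
          have "\<exists>n. (f ^^ n) v = y"
            using v y(1)
          proof (cases rule: isolated_comparable)
            case (2 n)
            then have "n = 0" using leaves[OF y(2), of n] v by (cases n) auto
            then have "(f ^^ 0) v = y" using 2 by simp
            then show ?thesis by blast
          qed blast
          then show "v \<in> range s" using s(2) by blast
        qed
      qed
      ultimately have "s 0 = y \<and> inj s \<and> (\<forall>k. iter_image f (- int k) {y} = {s k}) \<and> Iso = range s"
        using s unfolding iter_image_minus_int_singleton by simp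
      then have ?C using y unique trans dense leaves[OF y(2)] by metis
      then show ?thesis by blast
    qed
  qed simp
  moreover have "transitive_points f \<noteq> {}" if ?A
    using that by (simp add: is_single_periodic_orbit_system_def)
  then have "\<not> (?A \<and> ?B)" "\<not> (?A \<and> ?C)" by blast+
  moreover have "\<not> (?B \<and> ?C)"
  proof
    assume BC: "?B \<and> ?C"
    from ex1_implies_ex[OF conjunct1[OF conjunct2[OF BC]]] obtain y where y: "y \<in> Iso" "f y \<notin> Iso"
      by (elim exE conjE)
    have "full_orbit f y = Iso" using conjunct1[OF conjunct1[OF BC]] y(1) by simp
    moreover have "f y \<in> full_orbit f y"
      by (auto simp: mem_full_orbit_iff mem_forward_orbit_iff intro: exI[of _ 1])
    ultimately show False using y(2) by simp
  qed
  ultimately show ?thesis unfolding exactly_one_of_def by argo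
qed

section \<open>A dense orbit and the assembly of the cases\<close>

text \<open>The dense orbit is the forward orbit of the initial point in Case 1 and the full orbit
  of an isolated point otherwise. In Case 2 this full orbit is \<open>Iso\<close>, already known to
  be an orbit.\<close>

lemma dense_orbit: "has_dense_orbit f"
proof -
  consider "unique_isolated_without_preimage f" | "isolated_preimages_nonempty_some_two f"
    | "isolated_preimages_singletons f"
    using case_split unfolding exactly_one_of_def by blast
  then show ?thesis
  proof cases
    case 1
    then show ?thesis
      using initial_point_dense_orbit unfolding unique_isolated_without_preimage_def by blast
  next
    case 2
    then obtain x where x: "x \<in> Iso" "has_two_preimages f x" "\<forall>z\<in>Iso. f -` {z} \<noteq> {}"
      unfolding isolated_preimages_nonempty_some_two_def by blast
    have "closure Iso = UNIV" using branch_point(1)[OF x] full_orbit_dense[OF x(1)] by simp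
    then show ?thesis using branch_point(2)[OF x] unfolding has_dense_orbit_def by blast
  next
    case 3
    obtain p where p: "p \<in> Iso" using isolated_nonempty by blast
    obtain s where "orbit_sequence f UNIV s" "range s = full_orbit f p"
      using full_orbit_bi_infinite[OF singleton_preimages_iterated[OF 3 p]] by blast
    then have "is_orbit f (full_orbit f p)" unfolding is_orbit_def by metis
    then show ?thesis using full_orbit_dense[OF p] unfolding has_dense_orbit_def by blast
  qed
qed

lemma branching_case:
  assumes "isolated_preimages_nonempty_some_two f"
  shows "(\<exists>!x. x \<in> Iso \<and> has_two_preimages f x) \<and>
      (\<forall>x\<in>Iso. has_two_preimages f x \<longrightarrow>
        Iso = full_orbit f x \<and> infinite Iso \<and>
        (\<exists>l y. preperiodic_orbit f (full_orbit f x) x l \<and>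
           f -` {x} = {y, (f ^^ (l - 1)) x} \<and>
           (\<forall>k::nat. \<exists>z\<in>Iso. iter_image f (- int k) {y} = {z}))) \<and>
      transitive_points f = {} \<and> closure Iso = UNIV \<and> closure (range f) = UNIV"
proof -
  obtain x where x: "x \<in> Iso" "has_two_preimages f x" and nonempty: "\<forall>z\<in>Iso. f -` {z} \<noteq> {}"
    using assms unfolding isolated_preimages_nonempty_some_two_def by blast
  have dense: "closure Iso = UNIV"
    using branch_point(1)[OF x nonempty] full_orbit_dense[OF x(1)] by simp
  \<comment> \<open>Here \<open>Iso\<close> is dense and each of its points has a preimage, so the
    range is dense.\<close>
  moreover have "Iso \<subseteq> range f" by (rule isolated_subset_range[OF nonempty])
  then have "closure (range f) = UNIV" using closure_mono dense by blast
  moreover have "\<exists>!x. x \<in> Iso \<and> has_two_preimages f x"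
    using x branch_point_unique by blast
  moreover have "\<forall>x\<in>Iso. has_two_preimages f x \<longrightarrow>
        Iso = full_orbit f x \<and> infinite Iso \<and>
        (\<exists>l y. preperiodic_orbit f (full_orbit f x) x l \<and>
           f -` {x} = {y, (f ^^ (l - 1)) x} \<and>
           (\<forall>k::nat. \<exists>z\<in>Iso. iter_image f (- int k) {y} = {z}))"
    using branch_point(1)[OF _ _ nonempty] by (intro ballI impI)
  ultimately show ?thesis using branch_point(3)[OF x nonempty] by (intro conjI)
qed

end

theorem proposition5p11:
  fixes f :: "'a::t2_space \<Rightarrow> 'a"
  assumes "continuous_on UNIV f"
    and "topologically_transitive f"
    and "(isolated_points :: 'a set) \<noteq> {}"
  shows "has_dense_orbit f \<and>
    exactly_one_of
      (unique_isolated_without_preimage f)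
      (isolated_preimages_nonempty_some_two f)
      (isolated_preimages_singletons f) \<and>

    (unique_isolated_without_preimage f \<longrightarrow>
      (\<forall>x\<in>isolated_points. f -` {x} = {} \<longrightarrow>
        transitive_points f = {x} \<and> closure (range f) \<noteq> UNIV \<and>
        DO_plus f \<and> \<not> TT_plus f \<and> \<not> TT_plusplus f \<and> \<not> DO_plusplus f \<and>
        exactly_one_of
          (isolated_points = full_orbit f x \<and> full_orbit f x = forward_orbit f x \<and>
           infinite (isolated_points :: 'a set) \<and> inj (\<lambda>k. (f ^^ k) x) \<and>
           closure (isolated_points :: 'a set) = UNIV)
          (isolated_points = full_orbit f x \<and> full_orbit f x = forward_orbit f x \<and>
           forward_orbit f x = UNIV \<and> finite (isolated_points :: 'a set) \<and>
           (\<exists>k l y. k > 0 \<and> y = (f ^^ k) x \<and>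
              periodic_point f y \<and> (\<forall>j<k. \<not> periodic_point f ((f ^^ j) x)) \<and>
              preperiodic_orbit f (forward_orbit f x) y l \<and>
              f -` {y} = {(f ^^ (k - 1)) x, (f ^^ (l - 1)) y}))
          ((\<exists>n::nat. isolated_points = (\<lambda>k. (f ^^ k) x) ` {..<n} \<and>
              inj_on (\<lambda>k. (f ^^ k) x) {..<n} \<and>
              (\<forall>k\<ge>n. (f ^^ k) x \<notin> isolated_points)) \<and>
           infinite (UNIV :: 'a set) \<and>
           finite (isolated_points :: 'a set) \<and> closure (isolated_points :: 'a set) \<noteq> UNIV \<and>
           forward_orbit f x = full_orbit f x \<and> closure (forward_orbit f x) = UNIV))) \<and>

    (isolated_preimages_nonempty_some_two f \<longrightarrow>
      (\<exists>!x. x \<in> isolated_points \<and> has_two_preimages f x) \<and>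
      (\<forall>x\<in>isolated_points. has_two_preimages f x \<longrightarrow>
        isolated_points = full_orbit f x \<and> infinite (isolated_points :: 'a set) \<and>
        (\<exists>l y. preperiodic_orbit f (full_orbit f x) x l \<and>
           f -` {x} = {y, (f ^^ (l - 1)) x} \<and>
           (\<forall>k::nat. \<exists>z\<in>isolated_points. iter_image f (- int k) {y} = {z}))) \<and>
      transitive_points f = {} \<and>
      closure (isolated_points :: 'a set) = UNIV \<and> closure (range f) = UNIV) \<and>

    (isolated_preimages_singletons f \<longrightarrow>
      exactly_one_of
        (is_single_periodic_orbit_system f)
        ((\<forall>x\<in>isolated_points. full_orbit f x = isolated_points \<and>
            (\<exists>s. orbit_sequence f UNIV s \<and> range s = full_orbit f x)) \<and>
         transitive_points f = {} \<and>
         closure (isolated_points :: 'a set) = UNIV \<and> closure (range f) = UNIV)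
        ((\<exists>!y. y \<in> isolated_points \<and> f y \<notin> isolated_points) \<and>
         (\<forall>y\<in>isolated_points. f y \<notin> isolated_points \<longrightarrow>
            (\<exists>s::nat \<Rightarrow> 'a. s 0 = y \<and> inj s \<and>
               (\<forall>k. iter_image f (- int k) {y} = {s k}) \<and> isolated_points = range s) \<and>
            (\<forall>k>0. (f ^^ k) y \<notin> isolated_points)) \<and>
         transitive_points f = {} \<and> closure (range f) = UNIV)) \<and>

    (TT_plusplus f \<longleftrightarrow> isolated_preimages_singletons f \<and> is_single_periodic_orbit_system f) \<and>
    (TT_plus f \<longleftrightarrow> isolated_preimages_singletons f \<and> is_single_periodic_orbit_system f) \<and>
    (DO_plusplus f \<longleftrightarrow> isolated_preimages_singletons f \<and> is_single_periodic_orbit_system f)"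
proof -
  interpret transitive_system_with_isolated_points f
    using assms by unfold_locales
  note recurrence = recurrence_iff_single_periodic_orbit
  show ?thesis
    by (rule conjI[OF dense_orbit], rule conjI[OF case_split], rule conjI, intro impI ballI)
      (intro conjI initial_point initial_point_subcases impI branching_case
        singleton_preimages_subcases recurrence; assumption)+
qed

end
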